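(* Let $G$ be a connected graph, $L$ a constant capacity function (uniform capacities) and $k$ a positive integer. (a) If LP1 for $(G,L,k)$ is feasible, then $G^6$ admits a hard-capacitated $k$-center solution. (b) If soft LP1 for $(G,L,k)$ is feasible, then $G^5$ admits a soft-capacitated $k$-center solution.
   Context: $G=(V,E)$ undirected unweighted, $\mathrm{dist}_G$ shortest-path distance, $L:V\to\mathbb{N}$, $k$ a positive integer. LP1: variables $x_{u,v},y_u$ with (1) $\sum_u y_u=k$; (2) $x_{u,v}\le y_u$; (3) $\sum_v x_{u,v}\le L(u)y_u$; (4) $\sum_u x_{u,v}=1$; (5) $0\le y_u\le1$; (6) $x_{u,v}=0$ if $\mathrm{dist}_G(u,v)>1$; (7) $x_{u,v}\ge0$. Soft LP1 is LP1 with the upper bound $y_u\le 1$ removed. $G^\delta$ is the graph on $V$ with $uv$ an edge iff $\mathrm{dist}_G(u,v)\le\delta$. A hard-capacitated $k$-center solution in a graph $H$ on $V$: a set $S\subseteq V$, $|S|\le k$, and $\phi:V\to S$ with $\phi(v)=v$ or $\phi(v)v\in E(H)$, and $|\phi^{-1}(u)|\le L(u)$. A soft-capacitated $k$-center solution in $H$: $m:V\to\mathbb{Z}_{\ge0}$ with $\sum m(u)\le k$ and $\phi:V\to V$ with $m(\phi(v))\ge1$, $\phi(v)=v$ or $\phi(v)v\in E(H)$, and $|\phi^{-1}(u)|\le L(u)m(u)$. *)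

theory Defs
  imports Main "HOL-Library.Extended_Nat"
begin

definition graph :: "'a set \<Rightarrow> ('a \<Rightarrow> 'a \<Rightarrow> bool) \<Rightarrow> bool" where
  "graph V E \<longleftrightarrow> finite V \<and> (\<forall>u v. E u v \<longrightarrow> u \<in> V \<and> v \<in> V)
     \<and> (\<forall>u v. E u v \<longrightarrow> E v u) \<and> (\<forall>u. \<not> E u u)"

definition gdist :: "('a \<Rightarrow> 'a \<Rightarrow> bool) \<Rightarrow> 'a \<Rightarrow> 'a \<Rightarrow> enat" where
  "gdist E u v = (if \<exists>n. (E ^^ n) u v then enat (LEAST n. (E ^^ n) u v) else \<infinity>)"

definition connected_graph :: "'a set \<Rightarrow> ('a \<Rightarrow> 'a \<Rightarrow> bool) \<Rightarrow> bool" where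
  "connected_graph V E \<longleftrightarrow> graph V E \<and> V \<noteq> {} \<and> (\<forall>u\<in>V. \<forall>v\<in>V. gdist E u v < \<infinity>)"

definition graph_pow :: "('a \<Rightarrow> 'a \<Rightarrow> bool) \<Rightarrow> nat \<Rightarrow> 'a \<Rightarrow> 'a \<Rightarrow> bool" where
  "graph_pow E \<delta> u v \<longleftrightarrow> u \<noteq> v \<and> gdist E u v \<le> enat \<delta>"

definition LP1_point :: "bool \<Rightarrow> 'a set \<Rightarrow> ('a \<Rightarrow> 'a \<Rightarrow> bool) \<Rightarrow> ('a \<Rightarrow> nat) \<Rightarrow> nat
    \<Rightarrow> ('a \<Rightarrow> 'a \<Rightarrow> real) \<Rightarrow> ('a \<Rightarrow> real) \<Rightarrow> bool" where
  "LP1_point soft V E L k x y \<longleftrightarrow>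
     (\<Sum>u\<in>V. y u) = real k
   \<and> (\<forall>u\<in>V. \<forall>v\<in>V. x u v \<le> y u)
   \<and> (\<forall>u\<in>V. (\<Sum>v\<in>V. x u v) \<le> real (L u) * y u)
   \<and> (\<forall>v\<in>V. (\<Sum>u\<in>V. x u v) = 1)
   \<and> (\<forall>u\<in>V. 0 \<le> y u \<and> (\<not> soft \<longrightarrow> y u \<le> 1))
   \<and> (\<forall>u\<in>V. \<forall>v\<in>V. gdist E u v > 1 \<longrightarrow> x u v = 0)
   \<and> (\<forall>u\<in>V. \<forall>v\<in>V. 0 \<le> x u v)"

definition LP1_feasible :: "'a set \<Rightarrow> ('a \<Rightarrow> 'a \<Rightarrow> bool) \<Rightarrow> ('a \<Rightarrow> nat) \<Rightarrow> nat \<Rightarrow> bool" where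
  "LP1_feasible V E L k \<longleftrightarrow> (\<exists>x y. LP1_point False V E L k x y)"

definition soft_LP1_feasible :: "'a set \<Rightarrow> ('a \<Rightarrow> 'a \<Rightarrow> bool) \<Rightarrow> ('a \<Rightarrow> nat) \<Rightarrow> nat \<Rightarrow> bool" where
  "soft_LP1_feasible V E L k \<longleftrightarrow> (\<exists>x y. LP1_point True V E L k x y)"

definition hard_kcenter_sol :: "'a set \<Rightarrow> ('a \<Rightarrow> 'a \<Rightarrow> bool) \<Rightarrow> ('a \<Rightarrow> nat) \<Rightarrow> nat
    \<Rightarrow> 'a set \<Rightarrow> ('a \<Rightarrow> 'a) \<Rightarrow> bool" where
  "hard_kcenter_sol V H L k S \<phi> \<longleftrightarrow>
     S \<subseteq> V \<and> card S \<le> k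
   \<and> (\<forall>v\<in>V. \<phi> v \<in> S \<and> (\<phi> v = v \<or> H (\<phi> v) v))
   \<and> (\<forall>u\<in>S. card {v\<in>V. \<phi> v = u} \<le> L u)"

definition has_hard_kcenter_sol :: "'a set \<Rightarrow> ('a \<Rightarrow> 'a \<Rightarrow> bool) \<Rightarrow> ('a \<Rightarrow> nat) \<Rightarrow> nat \<Rightarrow> bool" where
  "has_hard_kcenter_sol V H L k \<longleftrightarrow> (\<exists>S \<phi>. hard_kcenter_sol V H L k S \<phi>)"

definition soft_kcenter_sol :: "'a set \<Rightarrow> ('a \<Rightarrow> 'a \<Rightarrow> bool) \<Rightarrow> ('a \<Rightarrow> nat) \<Rightarrow> nat
    \<Rightarrow> ('a \<Rightarrow> nat) \<Rightarrow> ('a \<Rightarrow> 'a) \<Rightarrow> bool" where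
  "soft_kcenter_sol V H L k m \<phi> \<longleftrightarrow>
     (\<Sum>u\<in>V. m u) \<le> k
   \<and> (\<forall>v\<in>V. \<phi> v \<in> V \<and> m (\<phi> v) \<ge> 1 \<and> (\<phi> v = v \<or> H (\<phi> v) v))
   \<and> (\<forall>u\<in>V. card {v\<in>V. \<phi> v = u} \<le> L u * m u)"

definition has_soft_kcenter_sol :: "'a set \<Rightarrow> ('a \<Rightarrow> 'a \<Rightarrow> bool) \<Rightarrow> ('a \<Rightarrow> nat) \<Rightarrow> nat \<Rightarrow> bool" where
  "has_soft_kcenter_sol V H L k \<longleftrightarrow> (\<exists>m \<phi>. soft_kcenter_sol V H L k m \<phi>)"

end

(*
  By Hall's theorem it suffices to find integral multiplicities mu of total k such that every
  vertex set W sees, within distance r, at least as many centers as the fractional opening y(W)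
  (r = 5 for hard, r = 4 for soft capacities; one more step is lost between a client and the
  fractional centers serving it).

  Choose monarchs at pairwise distance at least 3, arranged in a tree whose edges join monarchs
  at distance exactly 3, and assign each vertex to a monarch within distance 2. A monarch m has
  y(N[m]) >= 1. Going up the tree, each subtree opens integrally many centers and passes a
  leftover f in [0,1] to the parent; the leftover is taken from N[m], so it only has to travel
  1 + 3 to reach the parent monarch.

  Soft capacities: all new centers are opened at the monarch itself. Hard capacities: a subtree
  rooted at m, reached from its parent by the path m - b - a - parent, keeps b free of centers.
  Subtrees sharing the hub a are merged first by opening all but one of their free vertices b;
  the monarch then has one free vertex for each hub, besides its own cluster.
*)
theory Submission
  imports Defs Complex_Main "HOL-Library.Disjoint_Sets"
begin

section \<open>Hall's theorem and its capacitated form\<close>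

text \<open>Induction on \<open>card I\<close> in the Halmos-Vaughan style. A tight nonempty proper
  subfamily is matched by itself, and the rest inherits Hall's condition outside its union. If every
  such subfamily has slack, one index may take any of its elements.\<close>

lemma hall_marriage:
  fixes A :: "'i \<Rightarrow> 'b set"
  assumes "finite I" "\<And>i. i \<in> I \<Longrightarrow> finite (A i)"
    and "\<And>J. J \<subseteq> I \<Longrightarrow> card J \<le> card (\<Union>j\<in>J. A j)"
  shows "\<exists>f. inj_on f I \<and> (\<forall>i\<in>I. f i \<in> A i)"
  using assms
proof (induction "card I" arbitrary: I A rule: less_induct)
  case less
  note fin = \<open>finite I\<close> and finA = less.prems(2) and hall = less.prems(3)
  show ?case
  proof (cases "I = {}")
    case True
    then show ?thesis by auto
  next
    case False
    show ?thesis
    proof (cases "\<exists>J. J \<noteq> {} \<and> J \<subset> I \<and> card (\<Union>j\<in>J. A j) = card J")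
      case True
      then obtain J where J: "J \<noteq> {}" "J \<subset> I" "card (\<Union>j\<in>J. A j) = card J" by blast
      define U where "U = (\<Union>j\<in>J. A j)"
      have finJ: "finite J" using J(2) fin finite_subset by blast
      have finU: "finite U" unfolding U_def using finJ J(2) finA by auto
      have "\<exists>f. inj_on f J \<and> (\<forall>i\<in>J. f i \<in> A i)"
        using J(2) finA hall by (intro less.hyps psubset_card_mono fin finJ) auto
      then obtain f where f: "inj_on f J" "\<And>i. i \<in> J \<Longrightarrow> f i \<in> A i" by blast
      have "\<exists>g. inj_on g (I - J) \<and> (\<forall>i\<in>I - J. g i \<in> A i - U)"
      proof (rule less.hyps)
        show "card (I - J) < card I" using J fin by (intro psubset_card_mono) auto
        fix K assume K: "K \<subseteq> I - J"
        have finK: "finite K" using K fin finite_subset by blast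
        have "card K + card J = card (K \<union> J)"
          using K finK finJ by (subst card_Un_disjoint) auto
        also have "\<dots> \<le> card (\<Union>j\<in>K \<union> J. A j)" using K J(2) by (intro hall) auto
        also have "(\<Union>j\<in>K \<union> J. A j) = (\<Union>j\<in>K. A j - U) \<union> U" unfolding U_def by auto
        also have "card \<dots> = card (\<Union>j\<in>K. A j - U) + card U"
          using finU finK K finA by (intro card_Un_disjoint) auto
        finally show "card K \<le> card (\<Union>j\<in>K. A j - U)" using J(3) U_def by simp
      qed (use fin finA in auto)
      then obtain g where g: "inj_on g (I - J)" "\<And>i. i \<in> I - J \<Longrightarrow> g i \<in> A i - U" by blast
      define h where "h i = (if i \<in> J then f i else g i)" for i
      have fU: "f i \<in> U" if "i \<in> J" for i using f(2) that U_def by blast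
      have "inj_on h I"
      proof (rule inj_onI)
        fix i i' assume i: "i \<in> I" "i' \<in> I" "h i = h i'"
        have "h j \<in> U \<longleftrightarrow> j \<in> J" if "j \<in> I" for j
          using that fU[of j] g(2)[of j] unfolding h_def by auto
        then have "i \<in> J \<longleftrightarrow> i' \<in> J" using i by metis
        show "i = i'"
        proof (cases "i \<in> J")
          case True
          then show ?thesis using i \<open>i \<in> J \<longleftrightarrow> i' \<in> J\<close> inj_onD[OF f(1), of i i'] by (simp add: h_def)
        next
          case False
          then show ?thesis using i \<open>i \<in> J \<longleftrightarrow> i' \<in> J\<close> inj_onD[OF g(1), of i i'] by (simp add: h_def)
        qed
      qed
      moreover have "\<forall>i\<in>I. h i \<in> A i" using f(2) g(2) unfolding h_def by auto
      ultimately show ?thesis by blast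
    next
      case False
      then have strict: "card J < card (\<Union>j\<in>J. A j)" if "J \<noteq> {}" "J \<subset> I" for J
        using that False hall[OF psubset_imp_subset[OF that(2)]] by (metis le_neq_implies_less)
      from \<open>I \<noteq> {}\<close> obtain i where i: "i \<in> I" by blast
      have "card (A i) \<ge> 1" using hall[of "{i}"] i by simp
      then obtain a where a: "a \<in> A i" by fastforce
      have "\<exists>g. inj_on g (I - {i}) \<and> (\<forall>j\<in>I - {i}. g j \<in> A j - {a})"
      proof (rule less.hyps)
        show "card (I - {i}) < card I" using i fin by (meson card_Diff1_less)
        fix K assume K: "K \<subseteq> I - {i}"
        show "card K \<le> card (\<Union>j\<in>K. A j - {a})"
        proof (cases "K = {}")
          case False
          then have "card K < card (\<Union>j\<in>K. A j)" using K i by (intro strict) auto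
          moreover have "(\<Union>j\<in>K. A j - {a}) = (\<Union>j\<in>K. A j) - {a}" by auto
          ultimately show ?thesis by (auto simp: card_Diff_singleton_if)
        qed simp
      qed (use fin finA in auto)
      then obtain g where g: "inj_on g (I - {i})" "\<And>j. j \<in> I - {i} \<Longrightarrow> g j \<in> A j - {a}" by blast
      have "inj_on (g(i := a)) I"
        using g unfolding inj_on_def by auto
      moreover have "\<forall>j\<in>I. (g(i := a)) j \<in> A j" using g(2) a by auto
      ultimately show ?thesis by blast
    qed
  qed
qed

text \<open>Hall's theorem with every \<open>u\<close> replaced by \<open>q u\<close> copies
  \<open>(u, i)\<close>; the first component of the matching is the assignment.\<close>

lemma hall_capacitated:
  fixes R :: "'a \<Rightarrow> 'a \<Rightarrow> bool" and q :: "'a \<Rightarrow> nat"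
  assumes fin: "finite V"
    and hall: "\<And>U. U \<subseteq> V \<Longrightarrow> card U \<le> (\<Sum>u | u \<in> V \<and> (\<exists>v\<in>U. R u v). q u)"
  shows "\<exists>\<phi>. \<forall>v\<in>V. \<phi> v \<in> V \<and> R (\<phi> v) v \<and> card {w\<in>V. \<phi> w = \<phi> v} \<le> q (\<phi> v)"
proof -
  define A where "A v = (SIGMA u:{u\<in>V. R u v}. {..<q u})" for v
  have "\<exists>f. inj_on f V \<and> (\<forall>v\<in>V. f v \<in> A v)"
  proof (rule hall_marriage)
    fix U assume U: "U \<subseteq> V"
    have "(\<Union>v\<in>U. A v) = (SIGMA u:{u\<in>V. \<exists>v\<in>U. R u v}. {..<q u})" unfolding A_def by auto
    then show "card U \<le> card (\<Union>v\<in>U. A v)" using hall[OF U] fin by simp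
  qed (use fin in \<open>auto simp: A_def\<close>)
  then obtain f where f: "inj_on f V" "\<And>v. v \<in> V \<Longrightarrow> f v \<in> A v" by blast
  have "card {w\<in>V. fst (f w) = u} \<le> q u" for u
  proof -
    have "f ` {w\<in>V. fst (f w) = u} \<subseteq> {u} \<times> {..<q u}" using f(2) unfolding A_def by fastforce
    moreover have "inj_on f {w\<in>V. fst (f w) = u}" using f(1) by (rule inj_on_subset) auto
    ultimately have "card {w\<in>V. fst (f w) = u} \<le> card ({u} \<times> {..<q u})"
      by (intro card_inj_on_le) auto
    then show ?thesis by (simp add: card_cartesian_product)
  qed
  moreover have "fst (f v) \<in> V \<and> R (fst (f v)) v" if "v \<in> V" for v
    using f(2)[OF that] unfolding A_def by auto
  ultimately show ?thesis by (intro exI[of _ "\<lambda>v. fst (f v)"]) auto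
qed

section \<open>Bottom-up induction along a rooted tree of clusters\<close>

text \<open>In the proof, \<open>F m\<close> is the union of the clusters in the subtree of
  \<open>m\<close>, and \<open>Q\<close> is carried from the leaves to the root, whose region is
  \<open>V\<close>. Both roundings run on this scheme with their own \<open>Q\<close>.\<close>

lemma rooted_tree_induct:
  fixes M V :: "'a set" and c par :: "'a \<Rightarrow> 'a" and depth :: "'a \<Rightarrow> nat"
    and Q :: "'a \<Rightarrow> 'a set \<Rightarrow> bool"
  assumes "finite M" "rt \<in> M" "par rt = rt" "depth rt = 0"
    and par: "\<And>m. m \<in> M - {rt} \<Longrightarrow> par m \<in> M \<and> depth m = Suc (depth (par m))"
    and c: "\<And>v. v \<in> V \<Longrightarrow> c v \<in> M"
    and step: "\<And>m F J. m \<in> M \<Longrightarrow> J = {j \<in> M - {rt}. par j = m} \<Longrightarrow> (\<And>j. j \<in> J \<Longrightarrow> Q j (F j)) \<Longrightarrow>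
        (\<And>j. j \<in> J \<Longrightarrow> F j \<subseteq> V - {v \<in> V. c v = m}) \<Longrightarrow> disjoint_family_on F J \<Longrightarrow>
        Q m ({v \<in> V. c v = m} \<union> (\<Union>j\<in>J. F j))"
  shows "Q rt V"
proof -
  define F where "F m = {v \<in> V. \<exists>n. (par ^^ n) (c v) = m}" for m
  have parM: "(par ^^ n) m \<in> M" if "m \<in> M" for n m
  proof (induction n)
    case (Suc n)
    then show ?case using par assms(2,3) by (cases "(par ^^ n) m = rt") auto
  qed (use that in simp)
  have dpar: "depth (par m) = depth m - 1" if "m \<in> M" for m
    using that par assms(3,4) by (cases "m = rt") auto
  have dpow: "depth ((par ^^ n) m) = depth m - n" if "m \<in> M" for n m
    by (induction n) (use that parM dpar in auto)
  have Frt: "F rt = V"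
  proof -
    have "(par ^^ depth (c v)) (c v) = rt" if "v \<in> V" for v
    proof (rule ccontr)
      assume "(par ^^ depth (c v)) (c v) \<noteq> rt"
      then show False using par[of "(par ^^ depth (c v)) (c v)"] parM dpow c that by force
    qed
    then show ?thesis unfolding F_def by auto
  qed
  have "Q m (F m)" if "m \<in> M" for m
    using that
  \<comment> \<open>The deepest vertices come first, so all children of \<open>m\<close> are settled
    before \<open>m\<close>.\<close>
  proof (induction "Max (depth ` M) - depth m" arbitrary: m rule: less_induct)
    case less
    define J where "J = {j \<in> M - {rt}. par j = m}"
    have dJ: "depth j = Suc (depth m)" if "j \<in> J" for j using par that unfolding J_def by auto
    have split: "F m = {v \<in> V. c v = m} \<union> (\<Union>j\<in>J. F j)"
    proof (intro equalityI subsetI)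
      fix v assume v: "v \<in> F m"
      then obtain n0 where "v \<in> V" "(par ^^ n0) (c v) = m" unfolding F_def by blast
      \<comment> \<open>The first arrival at \<open>m\<close> is taken because
        \<open>par rt = rt\<close> repeats the root; it forces the predecessor \<open>j\<close> of
        \<open>m\<close> to differ from \<open>rt\<close>.\<close>
      define n where "n = (LEAST n. (par ^^ n) (c v) = m)"
      have n: "(par ^^ n) (c v) = m" unfolding n_def by (rule LeastI) fact
      have least: "\<not> (par ^^ l) (c v) = m" if "l < n" for l
        using not_less_Least that unfolding n_def by blast
      show "v \<in> {v \<in> V. c v = m} \<union> (\<Union>j\<in>J. F j)"
      proof (cases n)
        case 0
        then show ?thesis using n \<open>v \<in> V\<close> by auto
      next
        case (Suc l)
        define j where "j = (par ^^ l) (c v)"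
        have "par j = m" "j \<in> M" using n Suc parM c \<open>v \<in> V\<close> unfolding j_def by auto
        moreover have "j \<noteq> rt" using least[of l] Suc \<open>par j = m\<close> assms(3) j_def by auto
        ultimately have "j \<in> J" unfolding J_def by auto
        moreover have "v \<in> F j" using \<open>v \<in> V\<close> unfolding F_def j_def by auto
        ultimately show ?thesis by blast
      qed
    next
      fix v assume "v \<in> {v \<in> V. c v = m} \<union> (\<Union>j\<in>J. F j)"
      then consider "v \<in> V" "c v = m" | j n where "v \<in> V" "j \<in> J" "(par ^^ n) (c v) = j"
        unfolding F_def by auto
      then show "v \<in> F m"
      proof cases
        case 1
        then show ?thesis unfolding F_def by (auto intro: exI[of _ 0])
      next
        case 2
        then have "(par ^^ Suc n) (c v) = m" unfolding J_def by auto
        then show ?thesis using 2 unfolding F_def by blast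
      qed
    qed
    have "Q m ({v \<in> V. c v = m} \<union> (\<Union>j\<in>J. F j))"
    proof (rule step[OF less.prems J_def])
      fix j assume j: "j \<in> J"
      have "j \<in> M" using j J_def by auto
      then have "depth j \<le> Max (depth ` M)" using \<open>finite M\<close> by auto
      then show "Q j (F j)" using less.hyps[of j] dJ[OF j] \<open>j \<in> M\<close> by auto
      show "F j \<subseteq> V - {v \<in> V. c v = m}"
        using dpow c dJ[OF j] unfolding F_def by fastforce
    next
      show "disjoint_family_on F J"
      proof (unfold disjoint_family_on_def, intro ballI impI, rule ccontr)
        fix i j assume ij: "i \<in> J" "j \<in> J" "i \<noteq> j" "F i \<inter> F j \<noteq> {}"
        then obtain v n n' where v: "v \<in> V" "(par ^^ n) (c v) = i" "(par ^^ n') (c v) = j"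
          unfolding F_def by blast
        then have "depth (c v) - n = Suc (depth m)" "depth (c v) - n' = Suc (depth m)"
          using dpow c dJ ij by metis+
        \<comment> \<open>The truncated subtractions are exact since their values are positive, so
          equal depths force equal numbers of steps.\<close>
        then have "n = n'" by linarith
        then show False using v ij by simp
      qed
    qed
    then show ?case using split by simp
  qed
  from this[OF \<open>rt \<in> M\<close>] Frt show ?thesis by simp
qed

section \<open>Distance bounds as walks of bounded length\<close>

definition near :: "('a \<Rightarrow> 'a \<Rightarrow> bool) \<Rightarrow> nat \<Rightarrow> 'a \<Rightarrow> 'a \<Rightarrow> bool" where
  "near E n u v \<longleftrightarrow> gdist E u v \<le> enat n"

text \<open>Walks of length at most \<open>n\<close> can be concatenated and reversed without
  attention to the \<open>LEAST\<close> inside \<open>gdist\<close>.\<close>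

lemma near_iff_walk: "near E n u v \<longleftrightarrow> (\<exists>i\<le>n. (E ^^ i) u v)"
proof
  assume "near E n u v"
  then have ex: "\<exists>i. (E ^^ i) u v" and "(LEAST i. (E ^^ i) u v) \<le> n"
    unfolding near_def gdist_def by (auto split: if_splits)
  moreover have "(E ^^ (LEAST i. (E ^^ i) u v)) u v" using ex by (rule LeastI_ex)
  ultimately show "\<exists>i\<le>n. (E ^^ i) u v" by blast
next
  assume "\<exists>i\<le>n. (E ^^ i) u v"
  then obtain i where i: "i \<le> n" "(E ^^ i) u v" by blast
  then have "(LEAST i. (E ^^ i) u v) \<le> n" using Least_le[of "\<lambda>i. (E ^^ i) u v" i] by simp
  then show "near E n u v" using i(2) unfolding near_def gdist_def by auto
qed

lemma near_refl [simp]: "near E n u u"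
  unfolding near_iff_walk by (auto intro!: exI[of _ 0])

lemma near_edge: "E u v \<Longrightarrow> near E 1 u v"
  unfolding near_iff_walk by (auto intro!: exI[of _ 1])

lemma near_mono: "near E n u v \<Longrightarrow> n \<le> n' \<Longrightarrow> near E n' u v"
  unfolding near_iff_walk using order_trans by blast

lemma near_trans:
  assumes "near E n u v" "near E n' v w" "n + n' \<le> l"
  shows "near E l u w"
proof -
  obtain i i' where "i \<le> n" "(E ^^ i) u v" "i' \<le> n'" "(E ^^ i') v w"
    using assms unfolding near_iff_walk by blast
  moreover from this have "(E ^^ (i + i')) u w" unfolding relpowp_add by blast
  ultimately show ?thesis using assms(3) unfolding near_iff_walk by (intro exI[of _ "i + i'"]) auto
qed

section \<open>Connected graphs, the tree of monarchs, and available centers\<close>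

locale conn_graph =
  fixes V :: "'a set" and E :: "'a \<Rightarrow> 'a \<Rightarrow> bool"
  assumes conn: "connected_graph V E"
begin

lemma fin: "finite V" and ne: "V \<noteq> {}" and edge_sym: "E u v \<Longrightarrow> E v u"
  and edge_V: "E u v \<Longrightarrow> u \<in> V \<and> v \<in> V" and edge_irrefl: "\<not> E u u"
  using conn unfolding connected_graph_def graph_def by auto

lemma near_sym: assumes "near E n u v" shows "near E n v u"
proof -
  have "(E ^^ i) v u" if "(E ^^ i) u v" for i
    using that
  proof (induction i arbitrary: v)
    case (Suc i)
    then obtain w where "(E ^^ i) u w" "E w v" by auto
    then have "(E ^^ i) w u" "E v w" using Suc.IH edge_sym by auto
    then show ?case by (rule relpowp_Suc_I2[rotated])
  qed auto
  then show ?thesis using assms unfolding near_iff_walk by blast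
qed

lemma walk_exists: "u \<in> V \<Longrightarrow> v \<in> V \<Longrightarrow> \<exists>n. (E ^^ n) u v"
  using conn unfolding connected_graph_def gdist_def by (auto split: if_splits)

lemma neighbour_exists:
  assumes "u \<in> V" "V \<noteq> {u}"
  shows "\<exists>w. E u w"
proof -
  obtain v where v: "v \<in> V" "v \<noteq> u" using assms by auto
  obtain n where n: "(E ^^ n) u v" using walk_exists assms(1) v(1) by blast
  then obtain l where "n = Suc l" using v by (cases n) auto
  then show ?thesis using n relpowp_Suc_D2 by metis
qed

text \<open>\<open>M\<close> is maximal among the sets that contain a fixed root, are pairwise more
  than 2 apart and carry a tree with links of length at most 3. Maximality makes it dominating: a
  walk from an undominated vertex to the root passes from an undominated to a dominated vertex, and
  the former could be attached as a new leaf.\<close>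

lemma monarch_tree:
  obtains M rt par depth where
    "M \<subseteq> V" "rt \<in> M" "par rt = rt" "depth rt = (0::nat)"
    "\<And>m m'. m \<in> M \<Longrightarrow> m' \<in> M \<Longrightarrow> near E 2 m m' \<Longrightarrow> m = m'"
    "\<And>v. v \<in> V \<Longrightarrow> \<exists>m\<in>M. near E 2 v m"
    "\<And>m. m \<in> M - {rt} \<Longrightarrow> par m \<in> M \<and> near E 3 m (par m) \<and> depth m = Suc (depth (par m))"
proof -
  obtain rt where rt: "rt \<in> V" using ne by blast
  define valid where "valid M \<longleftrightarrow> M \<subseteq> V \<and> rt \<in> M \<and>
    (\<forall>m\<in>M. \<forall>m'\<in>M. near E 2 m m' \<longrightarrow> m = m') \<and>
    (\<exists>par depth. par rt = rt \<and> depth rt = (0::nat) \<and>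
      (\<forall>m\<in>M - {rt}. par m \<in> M \<and> near E 3 m (par m) \<and> depth m = Suc (depth (par m))))" for M
  have "valid {rt}" using rt unfolding valid_def by (auto intro: exI[of _ id])
  moreover have "finite {M. valid M}"
    by (rule finite_subset[of _ "Pow V"]) (use fin in \<open>auto simp: valid_def\<close>)
  ultimately obtain M where M: "valid M" and max: "\<And>M'. valid M' \<Longrightarrow> M \<subseteq> M' \<Longrightarrow> M' = M"
    using finite_has_maximal[of "{M. valid M}"] by blast
  obtain par depth where pd: "par rt = rt" "depth rt = (0::nat)"
      "\<And>m. m \<in> M - {rt} \<Longrightarrow> par m \<in> M \<and> near E 3 m (par m) \<and> depth m = Suc (depth (par m))"
    using M unfolding valid_def by blast
  have MV: "M \<subseteq> V" "rt \<in> M" and sep: "\<And>m m'. m \<in> M \<Longrightarrow> m' \<in> M \<Longrightarrow> near E 2 m m' \<Longrightarrow> m = m'"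
    using M unfolding valid_def by auto
  have dom: "\<exists>m\<in>M. near E 2 v m" if v: "v \<in> V" for v
  proof (rule ccontr)
    assume far: "\<not> (\<exists>m\<in>M. near E 2 v m)"
    have "\<exists>w m. w \<in> V \<and> m \<in> M \<and> near E 3 w m \<and> \<not> (\<exists>m\<in>M. near E 2 w m)"
      if "(E ^^ n) w m" "m \<in> M" "w \<in> V" "\<not> (\<exists>m\<in>M. near E 2 w m)" for n w m
      using that
    proof (induction n arbitrary: w)
      case (Suc n)
      then obtain x where x: "E w x" "(E ^^ n) x m" using relpowp_Suc_D2 by metis
      show ?case
      proof (cases "\<exists>m\<in>M. near E 2 x m")
        case True
        then obtain m' where "m' \<in> M" "near E 2 x m'" by blast
        moreover from this have "near E 3 w m'" using near_trans[OF near_edge[of E, OF x(1)], of 2 m' 3] by simp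
        ultimately show ?thesis using Suc.prems by blast
      next
        case False
        then show ?thesis using Suc.IH[OF x(2)] Suc.prems edge_V[OF x(1)] by blast
      qed
    qed auto
    then obtain w m where w: "w \<in> V" "m \<in> M" "near E 3 w m" "\<not> (\<exists>m\<in>M. near E 2 w m)"
      using walk_exists[OF v rt] MV(2) v far by blast
    have wM: "w \<notin> M" using w(4) by (metis near_refl)
    have "valid (insert w M)"
      unfolding valid_def
    proof (intro conjI)
      show "\<forall>m\<in>insert w M. \<forall>m'\<in>insert w M. near E 2 m m' \<longrightarrow> m = m'"
        using sep w(4) near_sym by blast
      show "\<exists>par depth. par rt = rt \<and> depth rt = (0::nat) \<and> (\<forall>m\<in>insert w M - {rt}.
          par m \<in> insert w M \<and> near E 3 m (par m) \<and> depth m = Suc (depth (par m)))"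
        by (rule exI[of _ "par(w := m)"], rule exI[of _ "depth(w := Suc (depth m))"])
          (use w wM pd MV in auto)
    qed (use MV w in auto)
    then show False using max wM by blast
  qed
  show thesis using that[OF MV pd(1,2) sep dom pd(3)] by blast
qed

text \<open>The centers available to \<open>W\<close>: the right-hand side of Hall's condition for
  the fractional transfer.\<close>

definition cover :: "nat \<Rightarrow> ('a \<Rightarrow> nat) \<Rightarrow> 'a set \<Rightarrow> nat" where
  "cover r \<mu> W = (\<Sum>v | v \<in> V \<and> (\<exists>w\<in>W. near E r w v). \<mu> v)"

lemma cover_mono: "W \<subseteq> W' \<Longrightarrow> cover r \<mu> W \<le> cover r \<mu> W'"
  unfolding cover_def by (intro sum_mono2) (use fin in auto)

lemma cover_add: "cover r (\<lambda>v. \<mu> v + \<nu> v) W = cover r \<mu> W + cover r \<nu> W"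
  unfolding cover_def by (rule sum.distrib)

lemma cover_sum: "cover r (\<lambda>v. \<Sum>j\<in>J. \<mu> j v) W = (\<Sum>j\<in>J. cover r (\<mu> j) W)"
  unfolding cover_def by (rule sum.swap)

lemma sum_le_cover:
  assumes "B \<subseteq> V" "\<And>b. b \<in> B \<Longrightarrow> \<exists>w\<in>W. near E r w b"
  shows "sum \<mu> B \<le> cover r \<mu> W"
  unfolding cover_def by (intro sum_mono2) (use fin assms in auto)

lemma card_le_cover:
  assumes "B \<subseteq> V" "B \<subseteq> S" "\<And>b. b \<in> B \<Longrightarrow> \<exists>w\<in>W. near E r w b"
  shows "card B \<le> cover r (\<lambda>v. of_bool (v \<in> S)) W"
proof -
  have "card B = (\<Sum>b\<in>B. of_bool (b \<in> S))" using assms(2) by (simp add: subset_iff)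
  also have "\<dots> \<le> cover r (\<lambda>v. of_bool (v \<in> S)) W" using assms(1,3) by (rule sum_le_cover)
  finally show ?thesis .
qed

end

section \<open>Fractional openings and the merging of rounded regions\<close>

text \<open>The consequences of LP1 shared by both cases; the bound \<open>y v \<le> 1\<close> is
  assumed separately for hard capacities.\<close>

locale fractional_opening = conn_graph V E
  for V :: "'a set" and E :: "'a \<Rightarrow> 'a \<Rightarrow> bool" +
  fixes y :: "'a \<Rightarrow> real"
  assumes y_nonneg: "\<And>v. v \<in> V \<Longrightarrow> 0 \<le> y v"
    and y_ball: "\<And>v. v \<in> V \<Longrightarrow> 1 \<le> (\<Sum>u | u \<in> V \<and> near E 1 u v. y u)"
begin

text \<open>State of a processed region \<open>F\<close>: the multiplicities \<open>\<mu>\<close> absorb all of its opening up to a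
  leftover \<open>f\<close>, which may be charged only to sets meeting the port \<open>P\<close>. By Hall's theorem this encodes
  a fractional transfer within distance \<open>r\<close> in which the leftover leaves \<open>F\<close> through \<open>P\<close>.\<close>

definition rounded :: "nat \<Rightarrow> 'a set \<Rightarrow> 'a set \<Rightarrow> ('a \<Rightarrow> nat) \<Rightarrow> real \<Rightarrow> bool" where
  "rounded r P F \<mu> f \<longleftrightarrow> 0 \<le> f \<and> f \<le> 1 \<and> (\<forall>v. v \<notin> F \<longrightarrow> \<mu> v = 0)
    \<and> sum y F = real (sum \<mu> F) + f
    \<and> (\<forall>W\<subseteq>F. sum y W \<le> real (cover r \<mu> W) + of_bool (W \<inter> P \<noteq> {}) * f)"

text \<open>New centers \<open>\<nu>\<close> absorb the opening of a fresh block \<open>D\<close>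
  and the leftovers of the regions \<open>F j\<close>. A set \<open>W\<close> splits along these
  disjoint pieces and \<open>cover\<close> is additive, so the inequalities of the regions add up.
  Only \<open>cov\<close> remains to be checked, which charges the leftovers whose port meets
  \<open>W\<close>.\<close>

lemma rounded_merge:
  assumes "finite J" "disjoint_family_on F J"
    and F: "\<And>j. j \<in> J \<Longrightarrow> F j \<subseteq> V - D" "D \<subseteq> V"
    and R: "\<And>j. j \<in> J \<Longrightarrow> rounded r (P j) (F j) (\<mu> j) (f j)"
    and \<nu>0: "\<And>v. v \<notin> D \<union> (\<Union>j\<in>J. F j) \<Longrightarrow> \<nu> v = 0"
    and total: "sum y D + sum f J = real (sum \<nu> V) + f'" and f': "0 \<le> f'" "f' \<le> 1"
    and cov: "\<And>W. W \<subseteq> D \<union> (\<Union>j\<in>J. F j) \<Longrightarrow> sum y (W \<inter> D) + (\<Sum>j | j \<in> J \<and> W \<inter> P j \<noteq> {}. f j)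
        \<le> real (cover r \<nu> W) + of_bool (W \<inter> Q \<noteq> {}) * f'"
  shows "rounded r Q (D \<union> (\<Union>j\<in>J. F j)) (\<lambda>v. (\<Sum>j\<in>J. \<mu> j v) + \<nu> v) f'"
proof -
  let ?F = "D \<union> (\<Union>j\<in>J. F j)" and ?\<mu> = "\<lambda>v. (\<Sum>j\<in>J. \<mu> j v) + \<nu> v"
  have FV: "?F \<subseteq> V" using F by auto
  have finF: "finite (F j)" if "j \<in> J" for j using F(1)[OF that] fin finite_subset by fast
  have split: "sum y W = sum y (W \<inter> D) + (\<Sum>j\<in>J. sum y (W \<inter> F j))" if W: "W \<subseteq> ?F" for W
  proof -
    have "W = (W \<inter> D) \<union> (\<Union>j\<in>J. W \<inter> F j)" using W by auto
    moreover have "finite W" using finite_subset[OF W finite_subset[OF FV fin]] .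
    moreover have "sum y ((W \<inter> D) \<union> (\<Union>j\<in>J. W \<inter> F j)) = sum y (W \<inter> D) + sum y (\<Union>j\<in>J. W \<inter> F j)"
      using \<open>finite W\<close> \<open>finite J\<close> F by (intro sum.union_disjoint) auto
    moreover have "sum y (\<Union>j\<in>J. W \<inter> F j) = (\<Sum>j\<in>J. sum y (W \<inter> F j))"
      using \<open>finite J\<close> finF assms(2)
      by (intro sum.UNION_disjoint) (auto simp: disjoint_family_on_def)
    ultimately show ?thesis by simp
  qed
  have sum\<mu>: "sum (\<mu> j) ?F = sum (\<mu> j) (F j)" if "j \<in> J" for j
    using R[OF that] that FV finite_subset[OF FV fin]
    by (intro sum.mono_neutral_right) (auto simp: rounded_def)
  have sum\<nu>: "sum \<nu> ?F = sum \<nu> V"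
    by (rule sum.mono_neutral_left) (use \<nu>0 FV fin in auto)
  have "sum ?\<mu> ?F = (\<Sum>j\<in>J. sum (\<mu> j) (F j)) + sum \<nu> V"
    using sum\<mu> sum\<nu> by (simp add: sum.distrib sum.swap[of _ J])
  moreover have "sum y ?F = sum y D + (\<Sum>j\<in>J. sum y (F j))"
  proof -
    have "?F \<inter> D = D" "\<And>j. j \<in> J \<Longrightarrow> ?F \<inter> F j = F j" by auto
    then show ?thesis using split[of ?F] by simp
  qed
  moreover have "(\<Sum>j\<in>J. sum y (F j)) = real (\<Sum>j\<in>J. sum (\<mu> j) (F j)) + sum f J"
    using R by (simp add: rounded_def sum.distrib)
  ultimately have tot: "sum y ?F = real (sum ?\<mu> ?F) + f'" using total by simp
  have bound: "sum y W \<le> real (cover r ?\<mu> W) + of_bool (W \<inter> Q \<noteq> {}) * f'" if W: "W \<subseteq> ?F" for W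
  proof -
    have "sum y (W \<inter> F j) \<le> real (cover r (\<mu> j) W) + of_bool (W \<inter> P j \<noteq> {}) * f j" if j: "j \<in> J" for j
    proof -
      have "sum y (W \<inter> F j) \<le> real (cover r (\<mu> j) (W \<inter> F j)) + of_bool (W \<inter> F j \<inter> P j \<noteq> {}) * f j"
        using R[OF j] unfolding rounded_def by blast
      moreover have "cover r (\<mu> j) (W \<inter> F j) \<le> cover r (\<mu> j) W" by (rule cover_mono) auto
      moreover have "of_bool (W \<inter> F j \<inter> P j \<noteq> {}) * f j \<le> of_bool (W \<inter> P j \<noteq> {}) * f j"
        using R[OF j] unfolding rounded_def by (intro mult_right_mono) auto
      ultimately show ?thesis by linarith
    qed
    then have "(\<Sum>j\<in>J. sum y (W \<inter> F j))
        \<le> (\<Sum>j\<in>J. real (cover r (\<mu> j) W) + of_bool (W \<inter> P j \<noteq> {}) * f j)"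
      by (rule sum_mono)
    also have "\<dots> = real (\<Sum>j\<in>J. cover r (\<mu> j) W) + (\<Sum>j | j \<in> J \<and> W \<inter> P j \<noteq> {}. f j)"
      using \<open>finite J\<close> by (simp add: sum.distrib of_bool_def if_distrib[of "\<lambda>z. z * _"] sum.If_cases cong: if_cong)
        (auto intro!: sum.cong simp: Int_def)
    finally show ?thesis using split[OF W] cov[OF W] by (simp add: cover_add cover_sum)
  qed
  show ?thesis unfolding rounded_def using f' tot bound \<nu>0 R by (fastforce simp: rounded_def)
qed

end

section \<open>Choosing how many and which centers to open\<close>

text \<open>The integer part is the least possible one: a positive integer \<open>t\<close> leaves
  \<open>f = 1\<close>, and \<open>nat\<close> truncates to 0 at \<open>t = 0\<close>. Minimality
  later ensures that there are enough vertices for \<open>K\<close> centers.\<close>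

lemma nat_plus_unit_interval:
  fixes t :: real
  assumes "0 \<le> t"
  obtains K :: nat and f where "t = real K + f" "0 \<le> f" "f \<le> 1" "\<And>n. t \<le> real n + 1 \<Longrightarrow> K \<le> n"
proof
  let ?K = "nat (\<lceil>t\<rceil> - 1)"
  show "t = real ?K + (t - real ?K)" by simp
  show "0 \<le> t - real ?K" "t - real ?K \<le> 1" using assms by linarith+
  show "?K \<le> n" if "t \<le> real n + 1" for n using that by linarith
qed

text \<open>A choice with priority for \<open>B\<close>; the hubs are opened first in this
  way.\<close>

lemma exists_subset_comparable:
  assumes "finite X" "B \<subseteq> X" "K \<le> card X"
  obtains S where "S \<subseteq> X" "card S = K" "S \<subseteq> B \<or> B \<subseteq> S"
proof (cases "K \<le> card B")
  case True
  then obtain S where "S \<subseteq> B" "card S = K" by (meson obtain_subset_with_card_n)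
  then show ?thesis using that assms(2) by blast
next
  case False
  then obtain S where "B \<subseteq> S" "S \<subseteq> X" "card S = K"
    using exists_subset_between[of B K X] assms by auto
  then show ?thesis using that by blast
qed

lemma sum_disjoint_support:
  assumes "finite J" "disjoint_family_on F J" "j \<in> J" "v \<in> F j"
    and "\<And>i v. i \<in> J \<Longrightarrow> v \<notin> F i \<Longrightarrow> \<mu> i v = (0::nat)"
  shows "(\<Sum>i\<in>J. \<mu> i v) = \<mu> j v"
proof -
  have "v \<notin> F i" if "i \<in> J - {j}" for i
    using disjoint_family_onD[OF assms(2), of i j] that assms(3,4) by auto
  then have "(\<Sum>i\<in>J. \<mu> i v) = (\<Sum>i\<in>{j}. \<mu> i v)"
    using assms(1,3,5) by (intro sum.mono_neutral_right) auto
  then show ?thesis by simp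
qed

section \<open>Clusters around the monarchs\<close>

context conn_graph
begin

text \<open>A monarch within distance 1 has priority in the choice of \<open>c v\<close>. Monarchs
  are more than 2 apart, so there is at most one, and the closed neighbourhood of a monarch lies in
  its own cluster.\<close>

lemma clusters:
  obtains M rt par depth c where
    "M \<subseteq> V" "rt \<in> M" "par rt = rt" "depth rt = (0::nat)"
    "\<And>m m'. m \<in> M \<Longrightarrow> m' \<in> M \<Longrightarrow> near E 2 m m' \<Longrightarrow> m = m'"
    "\<And>m. m \<in> M - {rt} \<Longrightarrow> par m \<in> M \<and> near E 3 m (par m) \<and> depth m = Suc (depth (par m))"
    "\<And>v. v \<in> V \<Longrightarrow> c v \<in> M \<and> near E 2 v (c v)"
    "\<And>v m. v \<in> V \<Longrightarrow> m \<in> M \<Longrightarrow> near E 1 v m \<Longrightarrow> c v = m"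
proof (rule monarch_tree)
  fix M rt par depth
  assume t:
    "M \<subseteq> V" "rt \<in> M" "par rt = rt" "depth rt = (0::nat)"
    "\<And>m m'. m \<in> M \<Longrightarrow> m' \<in> M \<Longrightarrow> near E 2 m m' \<Longrightarrow> m = m'"
    "\<And>v. v \<in> V \<Longrightarrow> \<exists>m\<in>M. near E 2 v m"
    "\<And>m. m \<in> M - {rt} \<Longrightarrow> par m \<in> M \<and> near E 3 m (par m) \<and> depth m = Suc (depth (par m))"
  define c where "c v = (if \<exists>m\<in>M. near E 1 v m then SOME m. m \<in> M \<and> near E 1 v m
    else SOME m. m \<in> M \<and> near E 2 v m)" for v
  have c1: "c v \<in> M \<and> near E 1 v (c v)" if "\<exists>m\<in>M. near E 1 v m" for v
    using someI_ex[of "\<lambda>m. m \<in> M \<and> near E 1 v m"] that unfolding c_def by auto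
  have c2: "c v \<in> M \<and> near E 2 v (c v)" if "v \<in> V" for v
  proof (cases "\<exists>m\<in>M. near E 1 v m")
    case True
    then show ?thesis using c1[OF True] near_mono[of E 1 v "c v" 2] by auto
  next
    case False
    then show ?thesis using someI_ex[of "\<lambda>m. m \<in> M \<and> near E 2 v m"] t(6)[OF that] unfolding c_def by auto
  qed
  have "c v = m" if "m \<in> M" "near E 1 v m" for v m
  proof -
    have "c v \<in> M" "near E 1 v (c v)" using c1 that by auto
    moreover have "near E 2 (c v) m"
      using near_trans[OF near_sym[OF \<open>near E 1 v (c v)\<close>] that(2), of 2] by simp
    ultimately show ?thesis using t(5) that(1) by blast
  qed
  then show thesis using that[OF t(1-5) t(7) c2] by blast
qed

end

section \<open>Merging at a monarch and the soft rounding\<close>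

context fractional_opening
begin

lemma y_subset_le: "A \<subseteq> B \<Longrightarrow> B \<subseteq> V \<Longrightarrow> sum y A \<le> sum y B"
  by (rule sum_mono2) (use finite_subset[OF _ fin] y_nonneg in auto)

lemma y_ge_1:
  assumes "m \<in> V" "D \<subseteq> V" "{v \<in> V. near E 1 v m} \<subseteq> D"
  shows "1 \<le> sum y D"
  using y_ball[OF assms(1)] y_subset_le[OF assms(3,2)] by linarith

text \<open>The port is the closed neighbourhood of \<open>m\<close>, whose opening is at least 1
  and hence at least \<open>f'\<close>. A set that meets \<open>D\<close> but misses the port
  forgoes at least 1 of \<open>D\<close>, so it can do without \<open>f'\<close>. A set that misses
  \<open>D\<close> carries only leftovers of children.\<close>

lemma monarch_merge:
  assumes J: "finite J" "disjoint_family_on F J"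
    and F: "\<And>j. j \<in> J \<Longrightarrow> F j \<subseteq> V - D" "D \<subseteq> V"
    and R: "\<And>j. j \<in> J \<Longrightarrow> rounded r (P j) (F j) (\<mu> j) (f j)"
    and \<nu>0: "\<And>v. v \<notin> D \<union> (\<Union>j\<in>J. F j) \<Longrightarrow> \<nu> v = 0"
    and total: "sum y D + sum f J = real (sum \<nu> V) + f'" and f': "0 \<le> f'" "f' \<le> 1"
    and m: "m \<in> V" "{v \<in> V. near E 1 v m} \<subseteq> D"
    and covD: "\<And>W. W \<subseteq> V \<Longrightarrow> W \<inter> D \<noteq> {} \<Longrightarrow> sum \<nu> V \<le> cover r \<nu> W"
    and covJ: "\<And>W j. W \<subseteq> V \<Longrightarrow> j \<in> J \<Longrightarrow> W \<inter> P j \<noteq> {} \<Longrightarrow> sum f J \<le> real (cover r \<nu> W)"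
  shows "rounded r {v. near E 1 v m} (D \<union> (\<Union>j\<in>J. F j)) (\<lambda>v. (\<Sum>j\<in>J. \<mu> j v) + \<nu> v) f'"
proof (rule rounded_merge[OF J F R \<nu>0 total f'])
  fix W assume "W \<subseteq> D \<union> (\<Union>j\<in>J. F j)"
  then have W: "W \<subseteq> V" using F by blast
  let ?T = "{j \<in> J. W \<inter> P j \<noteq> {}}"
  have T: "sum f ?T \<le> sum f J"
    using J(1) R by (intro sum_mono2) (auto simp: rounded_def)
  show "sum y (W \<inter> D) + sum f ?T
      \<le> real (cover r \<nu> W) + of_bool (W \<inter> {v. near E 1 v m} \<noteq> {}) * f'"
  proof (cases "W \<inter> D = {}")
    case empty: True
    show ?thesis
    proof (cases "?T = {}")
      case True
      show ?thesis unfolding empty True using f'(1) by simp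
    next
      case False
      then obtain j where "j \<in> J" "W \<inter> P j \<noteq> {}" by auto
      then have "sum f ?T \<le> real (cover r \<nu> W)" using covJ[OF W] T by fastforce
      moreover have "0 \<le> of_bool (W \<inter> {v. near E 1 v m} \<noteq> {}) * f'" using f'(1) by simp
      ultimately show ?thesis unfolding empty by simp
    qed
  next
    case False
    then have cov: "real (sum \<nu> V) \<le> real (cover r \<nu> W)" by (intro of_nat_mono covD W)
    show ?thesis
    proof (cases "W \<inter> {v. near E 1 v m} = {}")
      case True
      let ?N = "{v \<in> V. near E 1 v m}"
      have "sum y (W \<inter> D) + sum y ?N = sum y (W \<inter> D \<union> ?N)"
        using True fin finite_subset[OF W fin] by (intro sum.union_disjoint[symmetric]) auto
      also have "\<dots> \<le> sum y D" using m(2) F(2) by (intro y_subset_le) auto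
      finally have "sum y (W \<inter> D) \<le> sum y D - 1" using y_ball[OF m(1)] by linarith
      then show ?thesis using True T total cov f' by simp
    next
      case False
      have "sum y (W \<inter> D) \<le> sum y D" using F(2) by (intro y_subset_le) auto
      then show ?thesis using False T total cov f' by simp
    qed
  qed
qed

text \<open>All new centers go to the monarch \<open>m\<close>. Its cluster reaches it within 2, the
  port of a child within 1 + 3 = 4.\<close>

lemma soft_rounding:
  obtains rt \<mu> f where "rt \<in> V" "rounded 4 {v. near E 1 v rt} V \<mu> f"
proof (rule clusters)
  fix M rt par depth c
  assume t:
    "M \<subseteq> V" "rt \<in> M" "par rt = rt" "depth rt = (0::nat)"
    "\<And>m m'. m \<in> M \<Longrightarrow> m' \<in> M \<Longrightarrow> near E 2 m m' \<Longrightarrow> m = m'"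
    "\<And>m. m \<in> M - {rt} \<Longrightarrow> par m \<in> M \<and> near E 3 m (par m) \<and> depth m = Suc (depth (par m))"
    "\<And>v. v \<in> V \<Longrightarrow> c v \<in> M \<and> near E 2 v (c v)"
    "\<And>v m. v \<in> V \<Longrightarrow> m \<in> M \<Longrightarrow> near E 1 v m \<Longrightarrow> c v = m"
  have finM: "finite M" using t(1) fin finite_subset by blast
  have "\<exists>\<mu> f. rounded 4 {v. near E 1 v rt} V \<mu> f"
  proof (rule rooted_tree_induct[of M rt par depth V c "\<lambda>m F. \<exists>\<mu> f. rounded 4 {v. near E 1 v m} F \<mu> f"])
    fix m F J
    assume m: "m \<in> M" and J: "J = {j \<in> M - {rt}. par j = m}"
      and ex: "\<And>j. j \<in> J \<Longrightarrow> \<exists>\<mu> f. rounded 4 {v. near E 1 v j} (F j) \<mu> f"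
      and F: "\<And>j. j \<in> J \<Longrightarrow> F j \<subseteq> V - {v \<in> V. c v = m}" and disj: "disjoint_family_on F J"
    obtain \<mu> f where R: "\<And>j. j \<in> J \<Longrightarrow> rounded 4 {v. near E 1 v j} (F j) (\<mu> j) (f j)"
      using ex by metis
    let ?D = "{v \<in> V. c v = m}"
    have mV: "m \<in> V" using m t(1) by auto
    have finJ: "finite J" using J finM by auto
    have ball: "{v \<in> V. near E 1 v m} \<subseteq> ?D" using t(8) m by auto
    have D1: "1 \<le> sum y ?D" using y_ge_1[OF mV _ ball] by auto
    have "0 \<le> sum f J" using R by (intro sum_nonneg) (auto simp: rounded_def)
    \<comment> \<open>One unit of the cluster is set aside before splitting. Then
      \<open>Suc K\<close> centers are opened at \<open>m\<close>, and as \<open>sum y ?D\<close> is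
      at least 1, they number at least \<open>sum f J\<close>.\<close>
    then have "0 \<le> sum y ?D - 1 + sum f J" using D1 by linarith
    then obtain K f' where K: "sum y ?D - 1 + sum f J = real K + f'" "0 \<le> f'" "f' \<le> 1"
      by (rule nat_plus_unit_interval) blast
    define \<nu> where "\<nu> v = (if v = m then Suc K else 0)" for v
    have \<nu>V: "sum \<nu> V = Suc K" using mV fin by (simp add: \<nu>_def)
    have cov: "Suc K \<le> cover 4 \<nu> W" if "w \<in> W" "near E 4 w m" for w W
      using sum_le_cover[of "{m}" W 4 \<nu>] that mV by (auto simp: \<nu>_def)
    have "rounded 4 {v. near E 1 v m} (?D \<union> (\<Union>j\<in>J. F j)) (\<lambda>v. (\<Sum>j\<in>J. \<mu> j v) + \<nu> v) f'"
    proof (rule monarch_merge[OF finJ disj F _ R _ _ K(2,3) mV ball])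
      show "\<nu> v = 0" if "v \<notin> ?D \<union> (\<Union>j\<in>J. F j)" for v
        using that ball mV unfolding \<nu>_def by auto
      show "sum y ?D + sum f J = real (sum \<nu> V) + f'" using K(1) \<nu>V by simp
      show "sum \<nu> V \<le> cover 4 \<nu> W" if W: "W \<inter> ?D \<noteq> {}" for W
      proof -
        obtain w where "w \<in> W" "w \<in> ?D" using W by blast
        then have "near E 4 w m" using t(7)[of w] near_mono[of E 2 w m 4] by auto
        then show ?thesis using cov \<open>w \<in> W\<close> \<nu>V by simp
      qed
      show "sum f J \<le> real (cover 4 \<nu> W)" if j: "j \<in> J" and W: "W \<inter> {v. near E 1 v j} \<noteq> {}" for W j
      proof -
        obtain w where "w \<in> W" "near E 1 w j" using W by auto
        moreover have "near E 3 j m" using t(6) j J by auto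
        ultimately have "Suc K \<le> cover 4 \<nu> W" using cov near_trans[of E 1 w j 3 m 4] by simp
        then show ?thesis using K D1 by linarith
      qed
    qed auto
    then show "\<exists>\<mu> f. rounded 4 {v. near E 1 v m} (?D \<union> (\<Union>j\<in>J. F j)) \<mu> f" by blast
  qed (use finM t in auto)
  then show thesis using that t(1,2) by blast
qed

section \<open>Hard rounding by hubs and monarchs\<close>

text \<open>The children in \<open>J\<close> share the hub \<open>a\<close>, which is adjacent to
  their free vertices \<open>b j\<close>. The integral part of the leftovers is opened at such
  vertices other than \<open>b j0\<close>, which stays free for the merged region. All child ports
  lie within 3 of \<open>a\<close>, so a set meeting one of them may also use the new
  leftover.\<close>

lemma hub_merge:
  assumes J: "finite J" "J \<noteq> {}" "disjoint_family_on F J" and F: "\<And>j. j \<in> J \<Longrightarrow> F j \<subseteq> V"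
    and R: "\<And>j. j \<in> J \<Longrightarrow> rounded 5 {v. near E 1 v j} (F j) (\<mu> j) (f j)"
    and le1: "\<And>j v. j \<in> J \<Longrightarrow> \<mu> j v \<le> 1"
    and b: "\<And>j. j \<in> J \<Longrightarrow> b j \<in> F j \<and> \<mu> j (b j) = 0 \<and> E a (b j) \<and> near E 2 j a"
  shows "\<exists>\<mu>' f' b'. rounded 5 {v. near E 3 v a} (\<Union>j\<in>J. F j) \<mu>' f' \<and> (\<forall>v. \<mu>' v \<le> 1)
    \<and> b' \<in> (\<Union>j\<in>J. F j) \<and> \<mu>' b' = 0 \<and> E a b'"
proof -
  obtain j0 where j0: "j0 \<in> J" using J(2) by blast
  have f: "0 \<le> f j \<and> f j \<le> 1" if "j \<in> J" for j using R[OF that] unfolding rounded_def by auto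
  have supp: "\<mu> j v = 0" if "j \<in> J" "v \<notin> F j" for j v using R that unfolding rounded_def by auto
  have "0 \<le> sum f J" using f by (intro sum_nonneg) auto
  then obtain K f' where K: "sum f J = real K + f'" "0 \<le> f'" "f' \<le> 1"
    "\<And>n. sum f J \<le> real n + 1 \<Longrightarrow> K \<le> n" using nat_plus_unit_interval by metis
  \<comment> \<open>Each leftover is at most 1, so minimality of \<open>K\<close> gives
    \<open>K \<le> card J - 1\<close>: there is room without \<open>b j0\<close>.\<close>
  have "sum f J \<le> real (card J)" using sum_bounded_above[of J f 1] f by auto
  moreover have "card J = Suc (card (J - {j0}))" using card.remove[OF J(1) j0] .
  ultimately have "K \<le> card (J - {j0})" using K(4) by auto
  moreover have same: "i = j" if "i \<in> J" "j \<in> J" "b i \<in> F j" for i j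
    using that b[of i] J(3) unfolding disjoint_family_on_def by blast
  have "inj_on b J" using same b by (metis inj_onI)
  then have "card (b ` (J - {j0})) = card (J - {j0})" by (meson card_image inj_on_subset Diff_subset)
  ultimately obtain S where S: "S \<subseteq> b ` (J - {j0})" "card S = K"
    by (metis obtain_subset_with_card_n)
  have SV: "S \<subseteq> V" using S(1) b F by fast
  define \<nu> :: "'a \<Rightarrow> nat" where "\<nu> v = of_bool (v \<in> S)" for v
  have \<nu>V: "sum \<nu> V = K" using SV S(2) fin by (simp add: \<nu>_def Int_absorb1)
  let ?\<mu> = "\<lambda>v. (\<Sum>j\<in>J. \<mu> j v) + \<nu> v"
  have \<mu>F: "?\<mu> v = \<mu> j v + \<nu> v" if "j \<in> J" "v \<in> F j" for j v
    using sum_disjoint_support[OF J(1,3) that, of \<mu>] supp by simp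
  have "rounded 5 {v. near E 3 v a} ({} \<union> (\<Union>j\<in>J. F j)) ?\<mu> f'"
  proof (rule rounded_merge[OF J(1,3) _ _ R _ _ K(2,3)])
    show "\<nu> v = 0" if "v \<notin> {} \<union> (\<Union>j\<in>J. F j)" for v using that S(1) b unfolding \<nu>_def by auto
    show "sum y {} + sum f J = real (sum \<nu> V) + f'" using K(1) \<nu>V by simp
    fix W assume W: "W \<subseteq> {} \<union> (\<Union>j\<in>J. F j)"
    let ?T = "{j \<in> J. W \<inter> {v. near E 1 v j} \<noteq> {}}"
    have T: "sum f ?T \<le> sum f J" using J(1) f by (intro sum_mono2) auto
    show "sum y (W \<inter> {}) + sum f ?T
        \<le> real (cover 5 \<nu> W) + of_bool (W \<inter> {v. near E 3 v a} \<noteq> {}) * f'"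
    proof (cases "?T = {}")
      case True
      show ?thesis unfolding True using K(2) by simp
    next
      case False
      then obtain j w where w: "j \<in> J" "w \<in> W" "near E 1 w j" by auto
      then have wa: "near E 3 w a" using b near_trans[of E 1 w j 2 a 3] by auto
      have "near E 5 w s" if s: "s \<in> S" for s
      proof -
        have "E a s" using s S(1) b by auto
        then show ?thesis using near_trans[OF wa near_edge] by auto
      qed
      then have "K \<le> cover 5 \<nu> W"
        using card_le_cover[of S S W 5] SV S(2) w(2) unfolding \<nu>_def by auto
      moreover have "W \<inter> {v. near E 3 v a} \<noteq> {}" using w wa by auto
      ultimately show ?thesis using T K(1) by simp
    qed
  qed (use F in auto)
  moreover have "?\<mu> v \<le> 1" for v
  proof (cases "v \<in> (\<Union>j\<in>J. F j)")
    case True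
    then obtain j where j: "j \<in> J" "v \<in> F j" by blast
    show ?thesis
    proof (cases "v \<in> S")
      case True
      then obtain i where "i \<in> J" "v = b i" using S(1) by auto
      \<comment> \<open>A new center sits on the free vertex of its region, where none was open
        before.\<close>
      then have "\<mu> j v = 0" using same[of i j] j b by auto
      then show ?thesis using \<mu>F[OF j] unfolding \<nu>_def by simp
    next
      case False
      then show ?thesis using \<mu>F[OF j] le1[OF j(1)] unfolding \<nu>_def by simp
    qed
  next
    case False
    then have "v \<notin> S" using S(1) b by auto
    then show ?thesis using False supp unfolding \<nu>_def by simp
  qed
  moreover have "?\<mu> (b j0) = 0"
  proof -
    have "b j0 \<notin> S" using S(1) same[OF j0] b by fastforce
    then show ?thesis using \<mu>F[OF j0] b[OF j0] unfolding \<nu>_def by simp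
  qed
  ultimately show ?thesis using b[OF j0] j0
    by (intro exI[of _ ?\<mu>] exI[of _ f'] exI[of _ "b j0"]) auto
qed

text \<open>The total is the integer \<open>k\<close>, so the leftover is 0 or 1; in the latter case
  one more center at \<open>p\<close> serves the entire port.\<close>

lemma rounded_finish:
  assumes R: "rounded r P V \<mu> f" and k: "sum y V = real k"
    and p: "p \<in> V" "\<And>w. w \<in> P \<Longrightarrow> near E r w p"
  shows "\<exists>\<mu>'. sum \<mu>' V = k \<and> (\<forall>W\<subseteq>V. sum y W \<le> real (cover r \<mu>' W)) \<and> (\<forall>v. \<mu>' v \<le> \<mu> v + of_bool (v = p))"
proof -
  have f: "0 \<le> f" "f \<le> 1" "real k = real (sum \<mu> V) + f"
    and cov: "\<And>W. W \<subseteq> V \<Longrightarrow> sum y W \<le> real (cover r \<mu> W) + of_bool (W \<inter> P \<noteq> {}) * f"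
    using R k unfolding rounded_def by auto
  show ?thesis
  proof (cases "f = 0")
    case True
    then have "sum \<mu> V = k" using f(3) by (metis add_0_right of_nat_eq_iff)
    then show ?thesis using True cov by (intro exI[of _ \<mu>]) simp
  next
    case False
    then have "real (sum \<mu> V) < real k" using f by linarith
    then have "sum \<mu> V < k" by (simp only: of_nat_less_iff)
    then have "f = 1" "k = Suc (sum \<mu> V)" using f(1,2) f(3)[symmetric] by linarith+
    let ?\<nu> = "\<lambda>v. of_bool (v \<in> {p}) :: nat"
    have "sum y W \<le> real (cover r (\<lambda>v. \<mu> v + ?\<nu> v) W)" if "W \<subseteq> V" for W
    proof (cases "W \<inter> P = {}")
      case True
      then show ?thesis using cov[OF that] unfolding cover_add by simp
    next
      case False
      then have "1 \<le> cover r ?\<nu> W" using card_le_cover[of "{p}" "{p}" W r] p by auto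
      then show ?thesis using cov[OF that] False \<open>f = 1\<close> unfolding cover_add by simp
    qed
    moreover have "sum (\<lambda>v. \<mu> v + ?\<nu> v) V = k"
      using p(1) fin \<open>k = Suc (sum \<mu> V)\<close> by (simp add: sum.distrib)
    ultimately show ?thesis by (intro exI[of _ "\<lambda>v. \<mu> v + ?\<nu> v"]) auto
  qed
qed

text \<open>A set \<open>W\<close> that touches only child branches is sure to reach \<open>m\<close> and the hubs in \<open>A\<close>, but not
  the free vertices \<open>b'\<close> of other hubs or the rest of \<open>D\<close>. Hence the hubs are opened first.\<close>

lemma monarch_branch:
  assumes y1: "\<And>v. v \<in> V \<Longrightarrow> y v \<le> 1"
    and A: "finite A" "\<And>x. x \<in> A \<Longrightarrow> E m x"
    and G: "disjoint_family_on G A" "\<And>x. x \<in> A \<Longrightarrow> G x \<subseteq> V - D" and D: "D \<subseteq> V"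
    and R: "\<And>x. x \<in> A \<Longrightarrow> rounded 5 {v. near E 3 v x} (G x) (\<mu> x) (f x)"
    and le1: "\<And>x v. x \<in> A \<Longrightarrow> \<mu> x v \<le> 1"
    and b': "\<And>x. x \<in> A \<Longrightarrow> b' x \<in> G x \<and> \<mu> x (b' x) = 0 \<and> E x (b' x)"
    and m: "m \<in> V" "{v \<in> V. near E 1 v m} \<subseteq> D" "\<And>v. v \<in> D \<Longrightarrow> near E 2 v m"
    and b: "E m b"
  shows "\<exists>\<mu>' f'. rounded 5 {v. near E 1 v m} (D \<union> (\<Union>x\<in>A. G x)) \<mu>' f'
    \<and> (\<forall>v. \<mu>' v \<le> 1) \<and> \<mu>' b = 0"
proof -
  have f: "0 \<le> f x \<and> f x \<le> 1" if "x \<in> A" for x using R[OF that] unfolding rounded_def by auto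
  have supp: "\<mu> x v = 0" if "x \<in> A" "v \<notin> G x" for x v using R that unfolding rounded_def by auto
  have finD: "finite D" using D fin finite_subset by blast
  have nbr_D: "x \<in> D" if "E m x" for x
    using m(2) edge_V[OF that] near_edge[of E x m, OF edge_sym[OF that]] by blast
  have AD: "A \<subseteq> D" using A(2) nbr_D by blast
  have bD: "b \<in> D" and mD: "m \<in> D" and "b \<noteq> m"
    using nbr_D[OF b] m(1,2) near_refl[of E 1 m] b edge_irrefl by auto
  have mA: "m \<notin> A" using A(2) edge_irrefl by auto
  have D1: "1 \<le> sum y D" using y_ge_1[OF m(1) D m(2)] .
  have f0: "0 \<le> sum f A" using f by (intro sum_nonneg) auto
  then have "0 \<le> sum y D - 1 + sum f A" using D1 by linarith
  then obtain K f' where K: "sum y D - 1 + sum f A = real K + f'" "0 \<le> f'" "f' \<le> 1"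
    "\<And>n. sum y D - 1 + sum f A \<le> real n + 1 \<Longrightarrow> K \<le> n"
    by (rule nat_plus_unit_interval) blast
  \<comment> \<open>The sites besides \<open>m\<close>, which is always opened: the cluster without
    \<open>b\<close>, and the free vertex of each hub region. There are
    \<open>card D - 2 + card A\<close> of them, which is at least \<open>K\<close> by the bounds on
    \<open>y\<close> and \<open>f\<close> and the minimality of \<open>K\<close>.\<close>
  define X where "X = (D - {m, b}) \<union> b' ` A"
  have b'D: "b' x \<notin> D" if "x \<in> A" for x using b' G(2) that by blast
  have b'G: "x = x'" if "x \<in> A" "x' \<in> A" "b' x \<in> G x'" for x x'
    using that b'[of x] G(1) unfolding disjoint_family_on_def by blast
  have "inj_on b' A" using b' b'G by (metis inj_onI)
  have finX: "finite X" using finD A(1) unfolding X_def by auto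
  have XV: "X \<subseteq> V" using D b' G(2) unfolding X_def by blast
  have "card X = card (D - {m, b}) + card A"
    unfolding X_def using finD A(1) b'D card_image[OF \<open>inj_on b' A\<close>]
    by (subst card_Un_disjoint) auto
  moreover have "card D = card (D - {m, b}) + 2"
  proof -
    have "card (D - {m, b}) = card D - card {m, b}" using mD bD by (intro card_Diff_subset) auto
    moreover have "card {m, b} \<le> card D" using mD bD finD by (intro card_mono) auto
    ultimately show ?thesis using \<open>b \<noteq> m\<close> by simp
  qed
  moreover have "sum y D \<le> real (card D)" using sum_bounded_above[of D y 1] y1 D by auto
  moreover have fA: "sum f A \<le> real (card A)" using sum_bounded_above[of A f 1] f by auto
  ultimately have "sum y D - 1 + sum f A \<le> real (card X) + 1" by simp
  then have KX: "K \<le> card X" by (rule K(4))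
  \<comment> \<open>The vertex \<open>b\<close> may itself be a hub and must stay closed.\<close>
  have "A - {b} \<subseteq> X" using AD mA unfolding X_def by blast
  then obtain S where S: "S \<subseteq> X" "card S = K" "S \<subseteq> A - {b} \<or> A - {b} \<subseteq> S"
    using exists_subset_comparable[OF finX _ KX] by metis
  have mS: "m \<notin> S" and bS: "b \<notin> S"
    using S(1) mD bD b'D unfolding X_def by auto
  have finS: "finite S" using S(1) finX finite_subset by blast
  have SV: "insert m S \<subseteq> V" using S(1) XV m(1) by auto
  define \<nu> :: "'a \<Rightarrow> nat" where "\<nu> v = of_bool (v \<in> insert m S)" for v
  have \<nu>V: "sum \<nu> V = Suc K"
  proof -
    have "sum \<nu> V = (\<Sum>v\<in>insert m S. 1)"
      unfolding \<nu>_def using fin SV by (intro sum.mono_neutral_cong_right) auto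
    then show ?thesis using mS finS S(2) by simp
  qed
  let ?\<mu> = "\<lambda>v. (\<Sum>x\<in>A. \<mu> x v) + \<nu> v"
  have "rounded 5 {v. near E 1 v m} (D \<union> (\<Union>x\<in>A. G x)) ?\<mu> f'"
  proof (rule monarch_merge[OF A(1) G(1,2) D R _ _ K(2,3) m(1,2)])
    show "\<nu> v = 0" if "v \<notin> D \<union> (\<Union>x\<in>A. G x)" for v
      using that S(1) mD b' unfolding \<nu>_def X_def by auto
    show "sum y D + sum f A = real (sum \<nu> V) + f'" using K(1) unfolding \<nu>V by simp
    show "sum \<nu> V \<le> cover 5 \<nu> W" if W: "W \<inter> D \<noteq> {}" for W
    proof -
      obtain w where w: "w \<in> W" "w \<in> D" using W by blast
      then have wm: "near E 2 w m" using m(3) by blast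
      \<comment> \<open>Every site is within 2 of \<open>m\<close>, so a set meeting the cluster
        sees all new centers.\<close>
      have "near E 5 w s" if s: "s \<in> insert m S" for s
      proof -
        consider "s \<in> D" | x where "x \<in> A" "s = b' x" using s S(1) mD unfolding X_def by blast
        then show ?thesis
        proof cases
          case 1
          then show ?thesis using near_trans[OF wm near_sym[OF m(3)], of s 5] by simp
        next
          case 2
          then have "near E 2 m s"
            using near_trans[OF near_edge near_edge, of E m x s 2] A(2) b' by simp
          then show ?thesis using near_trans[OF wm, of 2 s 5] by simp
        qed
      qed
      then have "card (insert m S) \<le> cover 5 \<nu> W"
        using card_le_cover[OF SV subset_refl, of W 5] w(1) unfolding \<nu>_def by blast
      then show ?thesis using \<nu>V mS finS S(2) by simp
    qed
    show "sum f A \<le> real (cover 5 \<nu> W)" if x: "x \<in> A" and W: "W \<inter> {v. near E 3 v x} \<noteq> {}" for W x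
    proof -
      obtain w where w: "w \<in> W" "near E 3 w x" using W by blast
      have wm: "near E 4 w m" using near_trans[OF w(2) near_edge, of m 4] edge_sym A(2) x by simp
      \<comment> \<open>A set entering through a hub region is only known to be within 4 of
        \<open>m\<close>, so it is credited with \<open>m\<close> and the open hubs alone.\<close>
      let ?B = "insert m (S \<inter> A)"
      have "near E 5 w s" if s: "s \<in> ?B" for s
      proof (cases "s = m")
        case True
        then show ?thesis using near_mono[OF wm, of 5] by simp
      next
        case False
        then show ?thesis using near_trans[OF wm near_edge, of s 5] s A(2) by simp
      qed
      then have "card ?B \<le> cover 5 \<nu> W"
        using card_le_cover[of ?B "insert m S" W 5] SV w(1) unfolding \<nu>_def by blast
      \<comment> \<open>If only hubs were opened, all \<open>Suc K\<close> new centers count.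
        Otherwise every hub except possibly \<open>b\<close> is open, and \<open>m\<close> makes up
        for that one, giving at least \<open>card A\<close> centers.\<close>
      moreover have "sum f A \<le> real (card ?B)"
        using S(3)
      proof
        assume "S \<subseteq> A - {b}"
        then have "S \<inter> A = S" by auto
        then have "card ?B = Suc K" using mS finS S(2) by simp
        moreover have "sum f A \<le> real K + 1" using K(1,3) D1 by linarith
        ultimately show ?thesis by simp
      next
        assume "A - {b} \<subseteq> S"
        then have "card (A - {b}) \<le> card (S \<inter> A)" using finS by (intro card_mono) auto
        moreover have "card A \<le> Suc (card (A - {b}))"
          by (metis card_Diff1_le card_Suc_Diff1 A(1) Diff_empty Diff_insert0 le_refl le_SucI)
        moreover have "card ?B = Suc (card (S \<inter> A))" using mS finS by simp
        ultimately have "card A \<le> card ?B" by simp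
        then show ?thesis using fA by simp
      qed
      ultimately show ?thesis by simp
    qed
  qed
  moreover have "?\<mu> v \<le> 1" for v
  proof (cases "v \<in> (\<Union>x\<in>A. G x)")
    case True
    then obtain x where x: "x \<in> A" "v \<in> G x" by blast
    have \<mu>v: "?\<mu> v = \<mu> x v + \<nu> v" using sum_disjoint_support[OF A(1) G(1) x, of \<mu>] supp by simp
    show ?thesis
    proof (cases "v \<in> insert m S")
      case True
      then obtain x' where "x' \<in> A" "v = b' x'" using S(1) mD G(2)[OF x(1)] x(2) unfolding X_def by blast
      then have "\<mu> x v = 0" using b'G[of x' x] x b' by auto
      then show ?thesis using \<mu>v unfolding \<nu>_def by simp
    next
      case False
      then show ?thesis using \<mu>v le1[OF x(1), of v] unfolding \<nu>_def by simp
    qed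
  next
    case False
    then show ?thesis using supp unfolding \<nu>_def by simp
  qed
  moreover have "?\<mu> b = 0"
  proof -
    have "(\<Sum>x\<in>A. \<mu> x b) = 0" using supp G(2) bD by (intro sum.neutral) blast
    then show ?thesis using bS \<open>b \<noteq> m\<close> unfolding \<nu>_def by simp
  qed
  ultimately show ?thesis by blast
qed

lemma hard_rounding:
  assumes y1: "\<And>v. v \<in> V \<Longrightarrow> y v \<le> 1" and V2: "\<And>u. V \<noteq> {u}"
  obtains rt b \<mu> f where "E rt b" "rounded 5 {v. near E 1 v rt} V \<mu> f" "\<And>v. \<mu> v \<le> 1" "\<mu> b = 0"
proof (rule clusters)
  fix M rt par depth c
  assume t:
    "M \<subseteq> V" "rt \<in> M" "par rt = rt" "depth rt = (0::nat)"
    "\<And>m m'. m \<in> M \<Longrightarrow> m' \<in> M \<Longrightarrow> near E 2 m m' \<Longrightarrow> m = m'"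
    "\<And>m. m \<in> M - {rt} \<Longrightarrow> par m \<in> M \<and> near E 3 m (par m) \<and> depth m = Suc (depth (par m))"
    "\<And>v. v \<in> V \<Longrightarrow> c v \<in> M \<and> near E 2 v (c v)"
    "\<And>v m. v \<in> V \<Longrightarrow> m \<in> M \<Longrightarrow> near E 1 v m \<Longrightarrow> c v = m"
  have finM: "finite M" using t(1) fin finite_subset by blast
  \<comment> \<open>The free vertex lies on the path to the parent, which is fixed outside the
    subtree. So \<open>Q\<close> offers a rounding for every neighbour \<open>b\<close> of
    \<open>m\<close>, and the rounding may change with \<open>b\<close>.\<close>
  define Q where "Q m F \<longleftrightarrow> (\<forall>b. E m b \<longrightarrow> b \<in> F \<and>
    (\<exists>\<mu> f. rounded 5 {v. near E 1 v m} F \<mu> f \<and> (\<forall>v. \<mu> v \<le> 1) \<and> \<mu> b = 0))" for m F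
  have "Q rt V"
  proof (rule rooted_tree_induct[of M rt par depth V c Q])
    fix m F J
    assume m: "m \<in> M" and J: "J = {j \<in> M - {rt}. par j = m}"
      and Q: "\<And>j. j \<in> J \<Longrightarrow> Q j (F j)"
      and F: "\<And>j. j \<in> J \<Longrightarrow> F j \<subseteq> V - {v \<in> V. c v = m}" and disj: "disjoint_family_on F J"
    let ?D = "{v \<in> V. c v = m}"
    have mV: "m \<in> V" using m t(1) by auto
    have finJ: "finite J" using J finM by auto
    have ball: "{v \<in> V. near E 1 v m} \<subseteq> ?D" using t(8) m by auto
    \<comment> \<open>Distinct monarchs are never within 2, so the link from \<open>j\<close> to
      \<open>m\<close> is a walk of length exactly 3; its inner vertices are the free vertex and the
      hub.\<close>
    have "\<exists>b a. E j b \<and> E b a \<and> E a m" if j: "j \<in> J" for j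
    proof -
      have jm: "j \<in> M" "near E 3 j m" "depth j = Suc (depth m)" using t(6) j J by auto
      then have "\<not> near E 2 j m" using t(5)[of j m] m by auto
      moreover obtain i where i: "i \<le> 3" "(E ^^ i) j m" using jm(2) unfolding near_iff_walk by blast
      ultimately have "\<not> i \<le> 2" unfolding near_iff_walk by blast
      then have "(E ^^ Suc (Suc (Suc 0))) j m" using i by (simp add: le_Suc_eq numeral_eq_Suc)
      then show ?thesis by auto
    qed
    then obtain b a where ba: "\<And>j. j \<in> J \<Longrightarrow> E j (b j) \<and> E (b j) (a j) \<and> E (a j) m" by metis
    have "\<exists>\<mu> f. b j \<in> F j \<and> rounded 5 {v. near E 1 v j} (F j) \<mu> f \<and> (\<forall>v. \<mu> v \<le> 1) \<and> \<mu> (b j) = 0"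
      if "j \<in> J" for j using Q[OF that] ba[OF that] unfolding Q_def by blast
    then obtain \<mu> f where R: "\<And>j. j \<in> J \<Longrightarrow> b j \<in> F j \<and> rounded 5 {v. near E 1 v j} (F j) (\<mu> j) (f j)
        \<and> (\<forall>v. \<mu> j v \<le> 1) \<and> \<mu> j (b j) = 0" by metis
    define H where "H x = {j \<in> J. a j = x}" for x
    define G where "G x = (\<Union>j\<in>H x. F j)" for x
    have HJ: "H x \<subseteq> J" for x unfolding H_def by auto
    have "\<exists>\<mu>' f' b'. rounded 5 {v. near E 3 v x} (G x) \<mu>' f' \<and> (\<forall>v. \<mu>' v \<le> 1)
        \<and> b' \<in> G x \<and> \<mu>' b' = 0 \<and> E x b'" if x: "x \<in> a ` J" for x
      unfolding G_def
    proof (rule hub_merge[where \<mu> = \<mu> and f = f and b = b])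
      show "finite (H x)" "H x \<noteq> {}" using finJ x unfolding H_def by auto
      show "disjoint_family_on F (H x)" using disj HJ by (rule disjoint_family_on_mono[rotated])
      fix j assume j: "j \<in> H x"
      then have jJ: "j \<in> J" "a j = x" unfolding H_def by auto
      show "F j \<subseteq> V" using F[OF jJ(1)] by blast
      show "rounded 5 {v. near E 1 v j} (F j) (\<mu> j) (f j)" "\<And>v. \<mu> j v \<le> 1" using R[OF jJ(1)] by auto
      have "near E 2 j (a j)" using near_trans[OF near_edge near_edge, of E j "b j" "a j" 2] ba[OF jJ(1)] by simp
      then show "b j \<in> F j \<and> \<mu> j (b j) = 0 \<and> E x (b j) \<and> near E 2 j x"
        using R[OF jJ(1)] ba[OF jJ(1)] edge_sym jJ(2) by blast
    qed
    then obtain \<mu>' f' b' where hub: "\<And>x. x \<in> a ` J \<Longrightarrow> rounded 5 {v. near E 3 v x} (G x) (\<mu>' x) (f' x) \<and>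
        (\<forall>v. \<mu>' x v \<le> 1) \<and> b' x \<in> G x \<and> \<mu>' x (b' x) = 0 \<and> E x (b' x)" by metis
    have GV: "G x \<subseteq> V - ?D" for x using F HJ unfolding G_def by blast
    have Gdisj: "disjoint_family_on G (a ` J)"
    proof (unfold disjoint_family_on_def, intro ballI impI)
      fix x x' :: 'a assume "x \<noteq> x'"
      then have "F j \<inter> F j' = {}" if "j \<in> H x" "j' \<in> H x'" for j j'
        using that disjoint_family_onD[OF disj, of j j'] unfolding H_def by auto
      then show "G x \<inter> G x' = {}" unfolding G_def by blast
    qed
    have Geq: "(\<Union>x\<in>a ` J. G x) = (\<Union>j\<in>J. F j)" unfolding G_def H_def by auto
    show "Q m (?D \<union> (\<Union>j\<in>J. F j))"
      unfolding Q_def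
    proof (intro allI impI conjI)
      fix b0 assume b0: "E m b0"
      have "near E 1 b0 m" using b0 edge_sym near_edge by metis
      then show "b0 \<in> ?D \<union> (\<Union>j\<in>J. F j)" using ball edge_V[OF b0] by blast
      show "\<exists>\<mu> f. rounded 5 {v. near E 1 v m} (?D \<union> (\<Union>j\<in>J. F j)) \<mu> f \<and> (\<forall>v. \<mu> v \<le> 1) \<and> \<mu> b0 = 0"
        unfolding Geq[symmetric]
      proof (rule monarch_branch[OF y1 _ _ Gdisj GV _ _ _ _ mV ball _ b0, where \<mu> = \<mu>' and f = f' and b' = b'])
        show "E m x" if "x \<in> a ` J" for x using that ba edge_sym by blast
        show "near E 2 v m" if "v \<in> ?D" for v using that t(7) by blast
      qed (use finJ hub in auto)
    qed
  qed (use finM t in auto)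
  \<comment> \<open>The root has no parent; any neighbour is kept free, to take a possible last
    center.\<close>
  moreover obtain b where "E rt b" using neighbour_exists V2 t(1,2) by blast
  ultimately show thesis using that unfolding Q_def by blast
qed

section \<open>From roundings to capacitated assignments\<close>

text \<open>The clients in \<open>U\<close> are served from their closed neighbourhood
  \<open>?N\<close>, so \<open>card U\<close> is at most \<open>c * sum y ?N\<close>. By
  \<open>cov\<close> this is at most \<open>c\<close> times the centers within \<open>r\<close> of
  \<open>?N\<close>, hence within \<open>r + 1\<close> of \<open>U\<close>. Uniformity lets the same
  factor \<open>c\<close> serve fractional and integral centers.\<close>

lemma capacitated_assignment:
  fixes L :: "'a \<Rightarrow> nat"
  assumes lp: "LP1_point soft V E L k x y" and L: "\<And>u. u \<in> V \<Longrightarrow> L u = c"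
    and cov: "\<And>W. W \<subseteq> V \<Longrightarrow> sum y W \<le> real (cover r \<mu> W)"
  shows "\<exists>\<phi>. \<forall>v\<in>V. \<phi> v \<in> V \<and> near E (Suc r) (\<phi> v) v \<and> card {w\<in>V. \<phi> w = \<phi> v} \<le> c * \<mu> (\<phi> v)"
proof (rule hall_capacitated[OF fin])
  fix U assume U: "U \<subseteq> V"
  let ?N = "{u \<in> V. \<exists>v\<in>U. near E 1 u v}"
  have x0: "x u v = 0" if "u \<in> V" "v \<in> V" "\<not> near E 1 u v" for u v
    using lp that unfolding LP1_point_def near_def by (auto simp: not_le one_enat_def)
  have xpos: "0 \<le> x u v" if "u \<in> V" "v \<in> V" for u v using lp that unfolding LP1_point_def by auto
  have "real (card U) = (\<Sum>v\<in>U. \<Sum>u\<in>V. x u v)"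
    using lp U unfolding LP1_point_def by (simp add: subset_iff)
  also have "\<dots> = (\<Sum>u\<in>V. \<Sum>v\<in>U. x u v)" by (rule sum.swap)
  also have "\<dots> = (\<Sum>u\<in>?N. \<Sum>v\<in>U. x u v)"
    using fin x0 U by (intro sum.mono_neutral_right) (auto intro!: sum.neutral)
  also have "\<dots> \<le> (\<Sum>u\<in>?N. \<Sum>v\<in>V. x u v)"
    using fin U xpos by (intro sum_mono sum_mono2) auto
  also have "\<dots> \<le> (\<Sum>u\<in>?N. real c * y u)"
    using lp L by (intro sum_mono) (auto simp: LP1_point_def)
  also have "\<dots> = real c * sum y ?N" by (rule sum_distrib_left[symmetric])
  also have "\<dots> \<le> real c * real (cover r \<mu> ?N)" using cov[of ?N] by (intro mult_left_mono) auto
  also have "\<dots> = real (\<Sum>v | v \<in> V \<and> (\<exists>w\<in>?N. near E r w v). c * \<mu> v)"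
    unfolding cover_def by (simp add: sum_distrib_left)
  finally have "card U \<le> (\<Sum>v | v \<in> V \<and> (\<exists>w\<in>?N. near E r w v). c * \<mu> v)"
    by (simp only: of_nat_le_iff)
  also have "\<dots> \<le> (\<Sum>v | v \<in> V \<and> (\<exists>u\<in>U. near E (Suc r) v u). c * \<mu> v)"
  proof (rule sum_mono2)
    show "{v \<in> V. \<exists>w\<in>?N. near E r w v} \<subseteq> {v \<in> V. \<exists>u\<in>U. near E (Suc r) v u}"
      using near_trans[OF near_sym, of r _ _ 1 _ "Suc r"] by fastforce
  qed (use fin in auto)
  finally show "card U \<le> (\<Sum>v | v \<in> V \<and> (\<exists>u\<in>U. near E (Suc r) v u). c * \<mu> v)" .
qed

end

text \<open>The unit demand of \<open>v\<close> is met inside its closed neighbourhood, and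
  \<open>x u v \<le> y u\<close>.\<close>

lemma LP1_fractional_opening:
  assumes "connected_graph V E" "LP1_point soft V E L k x y"
  shows "fractional_opening V E y"
proof -
  interpret conn_graph V E using assms(1) by unfold_locales
  show ?thesis
  proof
    fix v assume v: "v \<in> V"
    show "0 \<le> y v" using assms(2) v unfolding LP1_point_def by blast
    have "1 = (\<Sum>u\<in>V. x u v)" using assms(2) v unfolding LP1_point_def by auto
    also have "\<dots> = (\<Sum>u | u \<in> V \<and> near E 1 u v. x u v)"
      using assms(2) v fin unfolding LP1_point_def near_def
      by (intro sum.mono_neutral_right) (auto simp: not_le one_enat_def)
    also have "\<dots> \<le> (\<Sum>u | u \<in> V \<and> near E 1 u v. y u)"
      using assms(2) v unfolding LP1_point_def by (intro sum_mono) auto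
    finally show "1 \<le> (\<Sum>u | u \<in> V \<and> near E 1 u v. y u)" .
  qed
qed

section \<open>Soft and hard solutions\<close>

lemma soft_solution:
  fixes L :: "'a \<Rightarrow> nat"
  assumes conn: "connected_graph V E" and L: "\<And>u. u \<in> V \<Longrightarrow> L u = c" and feas: "soft_LP1_feasible V E L k"
  shows "has_soft_kcenter_sol V (graph_pow E 5) L k"
proof -
  obtain x y where lp: "LP1_point True V E L k x y" using feas unfolding soft_LP1_feasible_def by blast
  interpret fractional_opening V E y using LP1_fractional_opening[OF conn lp] .
  obtain rt \<mu>0 f where rt: "rt \<in> V" "rounded 4 {v. near E 1 v rt} V \<mu>0 f" by (rule soft_rounding)
  have k: "sum y V = real k" using lp unfolding LP1_point_def by blast
  obtain \<mu> where \<mu>: "sum \<mu> V = k" "\<And>W. W \<subseteq> V \<Longrightarrow> sum y W \<le> real (cover 4 \<mu> W)"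
    using rounded_finish[OF rt(2) k rt(1)] near_mono[of E 1 _ rt 4] by fastforce
  obtain \<phi> where \<phi>: "\<And>v. v \<in> V \<Longrightarrow> \<phi> v \<in> V \<and> near E (Suc 4) (\<phi> v) v
      \<and> card {w\<in>V. \<phi> w = \<phi> v} \<le> c * \<mu> (\<phi> v)"
    using capacitated_assignment[OF lp L \<mu>(2)] by blast
  have "soft_kcenter_sol V (graph_pow E 5) L k \<mu> \<phi>"
    unfolding soft_kcenter_sol_def
  proof (intro conjI ballI)
    fix v assume v: "v \<in> V"
    show "\<phi> v \<in> V" "\<phi> v = v \<or> graph_pow E 5 (\<phi> v) v"
      using \<phi>[OF v] unfolding graph_pow_def near_def by auto
    \<comment> \<open>The client \<open>v\<close> lies in this fibre, so the capacity bound forces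
      an open center.\<close>
    have "card {w\<in>V. \<phi> w = \<phi> v} > 0" using v fin by (subst card_gt_0_iff) auto
    then show "1 \<le> \<mu> (\<phi> v)" using \<phi>[OF v] by (cases "\<mu> (\<phi> v)") auto
  next
    fix u assume u: "u \<in> V"
    show "card {v \<in> V. \<phi> v = u} \<le> L u * \<mu> u"
    \<comment> \<open>The assignment bounds only the fibres over values of \<open>\<phi>\<close>;
      all others are empty.\<close>
    proof (cases "{v \<in> V. \<phi> v = u} = {}")
      case False
      then obtain v where "v \<in> V" "\<phi> v = u" by blast
      then show ?thesis using \<phi>[of v] L[OF u] by auto
    qed (simp only: card.empty)
  qed (use \<mu>(1) in simp)
  then show ?thesis unfolding has_soft_kcenter_sol_def by blast
qed

text \<open>Multiplicities at most 1 describe a set, their support \<open>?S\<close>. Radius 5 and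
  one step to the client give 6.\<close>

lemma hard_solution:
  fixes L :: "'a \<Rightarrow> nat"
  assumes conn: "connected_graph V E" and L: "\<And>u. u \<in> V \<Longrightarrow> L u = c" and feas: "LP1_feasible V E L k"
    and "k > 0"
  shows "has_hard_kcenter_sol V (graph_pow E 6) L k"
proof -
  obtain x y where lp: "LP1_point False V E L k x y" using feas unfolding LP1_feasible_def by blast
  interpret fractional_opening V E y using LP1_fractional_opening[OF conn lp] .
  have k: "sum y V = real k" and y1: "\<And>v. v \<in> V \<Longrightarrow> y v \<le> 1" using lp unfolding LP1_point_def by auto
  have "\<exists>\<mu>. sum \<mu> V = k \<and> (\<forall>W\<subseteq>V. sum y W \<le> real (cover 5 \<mu> W)) \<and> (\<forall>v\<in>V. \<mu> v \<le> 1)"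
  \<comment> \<open>A single vertex has no neighbour to keep free; there
    \<open>k = y u \<le> 1\<close> and \<open>k > 0\<close> give \<open>k = 1\<close>.\<close>
  proof (cases "\<exists>u. V = {u}")
    case True
    then obtain u where u: "V = {u}" by blast
    then have "k = 1" using k y1[of u] \<open>k > 0\<close> by simp
    have "sum y W \<le> real (cover 5 (\<lambda>_. 1) W)" if W: "W \<subseteq> V" for W
    proof -
      have "sum y W \<le> real (card W)" using sum_bounded_above[of W y 1] y1 W by auto
      also have "real (card W) \<le> real (cover 5 (\<lambda>_. 1) W)"
        using sum_le_cover[OF W, of W 5 "\<lambda>_. 1"] near_refl by fastforce
      finally show ?thesis .
    qed
    then show ?thesis using u \<open>k = 1\<close> by (intro exI[of _ "\<lambda>_. 1"]) auto
  next
    case False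
    then obtain rt b \<mu>0 f where rb: "E rt b" "rounded 5 {v. near E 1 v rt} V \<mu>0 f"
        "\<And>v. \<mu>0 v \<le> 1" "\<mu>0 b = 0" using hard_rounding[OF y1] by metis
    have "near E 5 w b" if "near E 1 w rt" for w
      using near_trans[OF that near_edge[of E, OF rb(1)], of 5] by simp
    then obtain \<mu> where \<mu>: "sum \<mu> V = k" "\<forall>W\<subseteq>V. sum y W \<le> real (cover 5 \<mu> W)"
        "\<And>v. \<mu> v \<le> \<mu>0 v + of_bool (v = b)"
      using rounded_finish[OF rb(2) k, of b] edge_V[OF rb(1)] by blast
    \<comment> \<open>The last center can only go to \<open>b\<close>, which was kept free for
      it.\<close>
    have "\<mu> v \<le> 1" for v using \<mu>(3)[of v] rb(3)[of v] rb(4) by (cases "v = b") auto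
    then show ?thesis using \<mu>(1,2) by blast
  qed
  then obtain \<mu> where \<mu>: "sum \<mu> V = k" "\<And>W. W \<subseteq> V \<Longrightarrow> sum y W \<le> real (cover 5 \<mu> W)"
      "\<And>v. v \<in> V \<Longrightarrow> \<mu> v \<le> 1" by blast
  obtain \<phi> where \<phi>: "\<And>v. v \<in> V \<Longrightarrow> \<phi> v \<in> V \<and> near E (Suc 5) (\<phi> v) v
      \<and> card {w\<in>V. \<phi> w = \<phi> v} \<le> c * \<mu> (\<phi> v)"
    using capacitated_assignment[OF lp L \<mu>(2)] by blast
  let ?S = "{v \<in> V. \<mu> v \<noteq> 0}"
  have \<phi>S: "\<phi> v \<in> ?S" if v: "v \<in> V" for v
  proof -
    have "card {w\<in>V. \<phi> w = \<phi> v} > 0" using v fin by (subst card_gt_0_iff) auto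
    then show ?thesis using \<phi>[OF v] by (cases "\<mu> (\<phi> v)") auto
  qed
  have "hard_kcenter_sol V (graph_pow E 6) L k ?S \<phi>"
    unfolding hard_kcenter_sol_def
  proof (intro conjI ballI)
    have "card ?S = sum (\<lambda>_. 1) ?S" by simp
    also have "\<dots> \<le> sum \<mu> ?S" by (rule sum_mono) auto
    also have "\<dots> \<le> sum \<mu> V" using fin by (intro sum_mono2) auto
    finally show "card ?S \<le> k" using \<mu>(1) by simp
  next
    fix v assume v: "v \<in> V"
    show "\<phi> v \<in> ?S" using \<phi>S[OF v] .
    show "\<phi> v = v \<or> graph_pow E 6 (\<phi> v) v"
      using \<phi>[OF v] unfolding graph_pow_def near_def by auto
  next
    fix u assume u: "u \<in> ?S"
    show "card {v \<in> V. \<phi> v = u} \<le> L u"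
    proof (cases "{v \<in> V. \<phi> v = u} = {}")
      case False
      then obtain v where "v \<in> V" "\<phi> v = u" by blast
      then have "card {v \<in> V. \<phi> v = u} \<le> c * \<mu> u" using \<phi>[of v] by auto
      also have "\<dots> \<le> L u" using \<mu>(3)[of u] L[of u] u by simp
      finally show ?thesis .
    qed (simp only: card.empty)
  qed auto
  then show ?thesis unfolding has_hard_kcenter_sol_def by blast
qed

theorem theorem7:
  fixes V :: "'a set" and E :: "'a \<Rightarrow> 'a \<Rightarrow> bool" and L :: "'a \<Rightarrow> nat" and k :: nat
  assumes "connected_graph V E"
    and "\<exists>c. \<forall>u\<in>V. L u = c"
    and "k > 0"
  shows "(LP1_feasible V E L k \<longrightarrow> has_hard_kcenter_sol V (graph_pow E 6) L k)
       \<and> (soft_LP1_feasible V E L k \<longrightarrow> has_soft_kcenter_sol V (graph_pow E 5) L k)"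
proof -
  obtain c where "\<And>u. u \<in> V \<Longrightarrow> L u = c" using assms(2) by blast
  then show ?thesis using hard_solution[OF assms(1)] soft_solution[OF assms(1)] assms(3) by blast
qed

end
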